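(* Let $\alpha\in\mathbb{R}$ be irrational and not a Liouville number, and let $\nu\in\mathbb{R}$ satisfy $$0<\nu<\frac{1}{w(\alpha)}.$$ Then there exists a constant $\varepsilon_0=\varepsilon_0(\alpha)>0$ such that for any sufficiently large $N\in\mathbb{N}$ and any $\varepsilon$ with $N^{-\nu}<\varepsilon<\varepsilon_0$, $$\lfloor\varepsilon N\rfloor\ \le\ \#\{n\in\mathbb{N}:\|n\alpha\|<\varepsilon,\ n\le N\}\ \le\ 32\,\varepsilon N.$$
   Context: $\|x\|$ denotes the distance from $x\in\mathbb{R}$ to the nearest integer. The exponent of approximation of $\alpha\in\mathbb{R}$ is $w(\alpha):=\sup\{w>0:\|q\alpha\|<q^{-w}\text{ for infinitely many }q\in\mathbb{N}\}$. An irrational $\alpha$ is a Liouville number if and only if $w(\alpha)=\infty$. *)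

theory Defs
  imports Complex_Main "HOL-Library.Extended_Real"
begin

definition dist_nearest_int :: "real \<Rightarrow> real" where
  "dist_nearest_int x = \<bar>x - of_int (round x)\<bar>"

(* The supremum is taken in the extended reals, so that it may be infinite. *)
definition approx_exponent :: "real \<Rightarrow> ereal" where
  "approx_exponent \<alpha> =
     Sup {ereal w | w::real. w > 0 \<and>
       infinite {q::nat. q \<ge> 1 \<and> dist_nearest_int (real q * \<alpha>) < real q powr (- w)}}"

(* Irrationality has to be required separately: the exponent of a rational number is infinite too. *)
definition liouville :: "real \<Rightarrow> bool" where
  "liouville \<alpha> \<longleftrightarrow> \<alpha> \<notin> \<rat> \<and> approx_exponent \<alpha> = \<infinity>"

end

theory Submission
  imports Defs "HOL-Analysis.Kronecker_Approximation_Theorem" "HOL-Real_Asymp.Real_Asymp"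
begin

text \<open>
  Suppose \<open>p/q\<close> is a fraction in lowest terms with \<open>\<bar>\<alpha> - p/q\<bar> \<le> 1/q\<^sup>2\<close>. While \<open>n\<close> runs through \<open>q\<close>
  consecutive integers, \<open>n\<alpha>\<close> stays within \<open>1/q\<close> of a translate of \<open>np/q\<close>, and \<open>np mod q\<close> takes every
  residue exactly once. The \<open>q\<close> points \<open>n\<alpha>\<close> are therefore distributed modulo 1 like the multiples of
  \<open>1/q\<close>, and \<open>2\<epsilon>q\<close> of them, up to an error of 3, lie within \<open>\<epsilon>\<close> of an integer
  (\<open>card_block_near_int\<close>). Cutting \<open>{1..N}\<close> into blocks of length \<open>q\<close> gives a count close to
  \<open>2\<epsilon>N\<close> as soon as \<open>q\<close> is large compared with \<open>1/\<epsilon>\<close>, so that the error 3 is negligible against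
  \<open>2\<epsilon>q\<close>, and small compared with \<open>N\<close>, so that the incomplete last block is negligible. The factor 2
  leaves room for both losses, and \<open>6/\<epsilon> \<le> q \<le> N/4\<close> suffices (\<open>card_near_int_bounds\<close>).

  It remains to find such a \<open>q\<close>. Dirichlet's theorem with bound \<open>T\<close>, the integer part of \<open>N/4\<close>, gives
  a reduced fraction with \<open>q \<le> T\<close> and \<open>\<bar>q\<alpha> - p\<bar> < 1/T\<close>. The hypothesis on \<open>\<nu>\<close> says that the exponent of
  approximation of \<open>\<alpha>\<close> is below \<open>1/\<nu>\<close>. If \<open>w\<close> lies strictly between the two, the distance of
  \<open>q\<alpha>\<close> to the integers is at least \<open>c q\<^sup>-\<^sup>w\<close>, so \<open>q\<close> is at least of order \<open>N\<close> to the power \<open>1/w\<close>.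
  Since \<open>1/w > \<nu>\<close>, this exceeds \<open>6 N\<^sup>\<nu> > 6/\<epsilon>\<close> for large \<open>N\<close> (\<open>eventually_denominator_between\<close>).
  The only restriction on \<open>\<epsilon>\<close> from above is that the arc of radius \<open>\<epsilon>\<close> around 0 must not cover the
  circle, so \<open>\<epsilon>\<^sub>0 = 1/2\<close> works.
\<close>

section \<open>The distance to the nearest integer\<close>

lemma dist_nearest_int_le: "dist_nearest_int x \<le> \<bar>x - of_int k\<bar>"
  unfolding dist_nearest_int_def by (rule round_diff_minimal)

text \<open>
  This combines the 1-Lipschitz property with invariance under integer translations.
\<close>
lemma dist_nearest_int_le_shift:
  "dist_nearest_int x \<le> dist_nearest_int y + \<bar>x - y - of_int k\<bar>"
  using dist_nearest_int_le[of x "round y + k"] unfolding dist_nearest_int_def by simp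

lemma dist_nearest_int_less_iff: "dist_nearest_int x < \<delta> \<longleftrightarrow> (\<exists>k. \<bar>x - of_int k\<bar> < \<delta>)"
  using dist_nearest_int_le le_less_trans unfolding dist_nearest_int_def by blast

lemma dist_nearest_int_pos:
  assumes "x \<notin> \<rat>"
  shows "0 < dist_nearest_int x"
proof -
  have "x \<noteq> of_int (round x)"
    using assms by (metis Rats_of_int)
  then show ?thesis unfolding dist_nearest_int_def by simp
qed

text \<open>
  The definition of the exponent leaves only finitely many \<open>q\<close> violating the bound with \<open>c = 1\<close>. At each
  of these the distance is positive because \<open>\<alpha>\<close> is irrational, and a smaller \<open>c\<close> absorbs them.
\<close>
lemma dist_nearest_int_ge_powr:
  fixes \<alpha> w :: real
  assumes irr: "\<alpha> \<notin> \<rat>" and w: "w > 0" "approx_exponent \<alpha> < ereal w"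
  obtains c where "c > 0" "\<And>q::nat. q \<ge> 1 \<Longrightarrow> c * real q powr (- w) \<le> dist_nearest_int (real q * \<alpha>)"
proof -
  define S where "S = {q::nat. q \<ge> 1 \<and> dist_nearest_int (real q * \<alpha>) < real q powr (- w)}"
  have fin: "finite S"
  proof (rule ccontr)
    assume "infinite S"
    then have "ereal w \<le> approx_exponent \<alpha>"
      unfolding approx_exponent_def using w(1) by (intro Sup_upper) (auto simp: S_def)
    then show False using w(2) by simp
  qed
  define c where "c = Min (insert 1 ((\<lambda>q. dist_nearest_int (real q * \<alpha>)) ` S))"
  have pos: "0 < dist_nearest_int (real q * \<alpha>)" if "q \<ge> 1" for q :: nat
  proof (rule dist_nearest_int_pos)
    show "real q * \<alpha> \<notin> \<rat>"
    proof
      assume "real q * \<alpha> \<in> \<rat>"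
      then have "real q * \<alpha> / real q \<in> \<rat>" by (intro Rats_divide) auto
      then show False using irr that by simp
    qed
  qed
  have "c > 0"
    unfolding c_def using fin pos by (auto simp: S_def)
  moreover have "c * real q powr (- w) \<le> dist_nearest_int (real q * \<alpha>)" if q: "q \<ge> 1" for q :: nat
  proof (cases "q \<in> S")
    case True
    then have "c \<le> dist_nearest_int (real q * \<alpha>)"
      unfolding c_def using fin by (intro Min_le) auto
    moreover have "real q powr (- w) \<le> real q powr 0"
      using q w(1) by (intro powr_mono) auto
    then have "c * real q powr (- w) \<le> c * 1"
      using \<open>c > 0\<close> q by (intro mult_left_mono) auto
    ultimately show ?thesis by simp
  next
    case False
    have "c \<le> 1"
      unfolding c_def using fin by (intro Min_le) auto
    then have "c * real q powr (- w) \<le> 1 * real q powr (- w)"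
      by (intro mult_right_mono) auto
    moreover have "real q powr (- w) \<le> dist_nearest_int (real q * \<alpha>)"
      using False q by (simp add: S_def)
    ultimately show ?thesis by linarith
  qed
  ultimately show ?thesis by (rule that)
qed

section \<open>Counting in a block of consecutive integers\<close>

lemma card_ints_in_open_interval:
  fixes a b :: real
  assumes "a \<le> b"
  shows "finite {k::int. a < of_int k \<and> of_int k < b}"
    and "b - a - 1 \<le> real (card {k::int. a < of_int k \<and> of_int k < b})"
    and "real (card {k::int. a < of_int k \<and> of_int k < b}) \<le> b - a + 1"
proof -
  have eq: "{k::int. a < of_int k \<and> of_int k < b} = {\<lfloor>a\<rfloor><..<\<lceil>b\<rceil>}"
    by (auto simp: floor_less_iff less_ceiling_iff)
  show "finite {k::int. a < of_int k \<and> of_int k < b}"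
    by (simp add: eq)
  show "b - a - 1 \<le> real (card {k::int. a < of_int k \<and> of_int k < b})"
    unfolding eq by simp linarith
  show "real (card {k::int. a < of_int k \<and> of_int k < b}) \<le> b - a + 1"
    unfolding eq using assms by simp linarith
qed

text \<open>
  The fractions \<open>r/q\<close> modulo 1 that lie in an arc of length \<open>2\<delta>\<close> correspond to the integers in a
  real interval of length \<open>2\<delta>q\<close>, by reduction modulo \<open>q\<close>. That reduction is always onto, which
  is enough for the upper bound; the lower bound also needs it to be injective, hence \<open>\<delta> \<le> 1/2\<close>.
\<close>
lemma card_shifted_fractions_near_int:
  fixes c \<delta> :: real and q :: nat
  assumes q: "q > 0"
  shows "\<delta> \<le> 1 / 2 \<Longrightarrow> 2 * \<delta> * q - 1 \<le> card {r\<in>{0..<int q}. dist_nearest_int (of_int r / q + c) < \<delta>}"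
    and "0 \<le> \<delta> \<Longrightarrow> card {r\<in>{0..<int q}. dist_nearest_int (of_int r / q + c) < \<delta>} \<le> 2 * \<delta> * q + 1"
proof -
  let ?R = "{r\<in>{0..<int q}. dist_nearest_int (of_int r / q + c) < \<delta>}"
  let ?K = "{k::int. q * (- c - \<delta>) < of_int k \<and> of_int k < q * (- c + \<delta>)}"
  have K_iff: "k \<in> ?K \<longleftrightarrow> \<bar>of_int k / q + c\<bar> < \<delta>" for k
    using q by (auto simp: abs_less_iff field_simps)
  have len: "q * (- c + \<delta>) - q * (- c - \<delta>) = 2 * \<delta> * q"
    by (simp add: algebra_simps)
  have reduce: "of_int (k mod int q) / real q + c - of_int (- (k div int q)) = of_int k / q + c" for k
    using of_int_div_aux[where 'a = real, of k "int q"] by simp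
  have image: "(\<lambda>k. k mod int q) ` ?K = ?R"
  proof
    show "(\<lambda>k. k mod int q) ` ?K \<subseteq> ?R"
    proof (rule image_subsetI)
      fix k assume "k \<in> ?K"
      then have "\<bar>of_int (k mod int q) / q + c - of_int (- (k div int q))\<bar> < \<delta>"
        unfolding K_iff reduce .
      then have "dist_nearest_int (of_int (k mod int q) / q + c) < \<delta>"
        unfolding dist_nearest_int_less_iff by blast
      then show "k mod int q \<in> ?R" using q by simp
    qed
    show "?R \<subseteq> (\<lambda>k. k mod int q) ` ?K"
    proof
      fix r assume r: "r \<in> ?R"
      then obtain z where "\<bar>of_int r / q + c - of_int z\<bar> < \<delta>"
        by (auto simp: dist_nearest_int_less_iff)
      moreover have "of_int (r - z * int q) / q + c = of_int r / real q + c - of_int z"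
        using q by (simp add: field_simps)
      ultimately have "r - z * int q \<in> ?K" by (simp only: K_iff)
      moreover have "r = (r - z * int q) mod int q"
        using r mod_mult_self1[of r "- z" "int q"] by simp
      ultimately show "r \<in> (\<lambda>k. k mod int q) ` ?K" by blast
    qed
  qed
  show "2 * \<delta> * q - 1 \<le> card ?R" if "\<delta> \<le> 1 / 2"
  proof (cases "0 \<le> \<delta>")
    case True
    have "inj_on (\<lambda>k. k mod int q) ?K"
    proof (rule inj_onI)
      fix k l assume kl: "k \<in> ?K" "l \<in> ?K" and "k mod int q = l mod int q"
      then have "int q dvd k - l" by (simp add: mod_eq_dvd_iff)
      moreover have "\<bar>k - l\<bar> < int q"
      proof -
        have "\<bar>real_of_int (k - l)\<bar> < 2 * \<delta> * q" using kl len by auto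
        also have "\<dots> \<le> 1 * real q" using that by (intro mult_right_mono) auto
        finally show ?thesis by simp
      qed
      ultimately show "k = l"
        using dvd_imp_le_int[of "k - l" "int q"] by force
    qed
    then have "card ?R = card ?K"
      unfolding image[symmetric] by (rule card_image)
    then show ?thesis
      using card_ints_in_open_interval(2)[of "q * (- c - \<delta>)" "q * (- c + \<delta>)"] True len
      by (simp add: mult_left_mono)
  next
    case False
    then have "2 * \<delta> * q \<le> 0" by (simp add: mult_nonpos_nonneg)
    then show ?thesis by linarith
  qed
  show "card ?R \<le> 2 * \<delta> * q + 1" if "0 \<le> \<delta>"
  proof -
    have le: "q * (- c - \<delta>) \<le> q * (- c + \<delta>)" using that by (intro mult_left_mono) auto
    have "card ?R \<le> card ?K"
      unfolding image[symmetric] by (rule card_image_le[OF card_ints_in_open_interval(1)[OF le]])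
    then show ?thesis
      using card_ints_in_open_interval(3)[OF le] len by linarith
  qed
qed

lemma bij_betw_mult_mod_block:
  fixes p :: int and q m :: nat
  assumes "q > 0" "coprime p (int q)"
  shows "bij_betw (\<lambda>n. int n * p mod int q) {m<..m + q} {0..<int q}"
proof -
  let ?r = "\<lambda>n. int n * p mod int q"
  have inj: "inj_on ?r {m<..m + q}"
  proof (rule inj_onI)
    fix a b assume ab: "a \<in> {m<..m + q}" "b \<in> {m<..m + q}" and "?r a = ?r b"
    then have "int q dvd (int a - int b) * p"
      by (simp add: mod_eq_dvd_iff left_diff_distrib)
    then have "int q dvd int a - int b"
      using assms(2) by (simp add: coprime_dvd_mult_left_iff coprime_commute)
    moreover have "\<bar>int a - int b\<bar> < int q" using ab by auto
    ultimately show "a = b" using dvd_imp_le_int[of "int a - int b" "int q"] by force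
  qed
  moreover have "?r ` {m<..m + q} = {0..<int q}"
    using inj assms(1) by (intro card_subset_eq) (auto simp: card_image)
  ultimately show ?thesis by (simp add: bij_betw_def)
qed

text \<open>
  Write \<open>n\<alpha> = np/q + m\<theta> + (n - m)\<theta>\<close> with \<open>\<theta> = \<alpha> - p/q\<close>. In the block the last term is at most
  \<open>1/q\<close> in absolute value, so replacing \<open>n\<alpha>\<close> by the equally spaced points \<open>np/q + m\<theta>\<close> changes the
  radius \<open>\<epsilon>\<close> by at most \<open>1/q\<close>. This costs 2 in the count, and rounding to integers costs 1 more.
\<close>
lemma card_block_near_int:
  fixes \<alpha> \<epsilon> :: real and p :: int and q m :: nat
  assumes q: "q > 0" and cop: "coprime p (int q)" and appr: "\<bar>q * \<alpha> - p\<bar> \<le> 1 / q"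
    and \<epsilon>: "0 \<le> \<epsilon>" "\<epsilon> \<le> 1 / 2"
  shows "2 * \<epsilon> * q - 3 \<le> card {n\<in>{m<..m + q}. dist_nearest_int (n * \<alpha>) < \<epsilon>}"
    and "card {n\<in>{m<..m + q}. dist_nearest_int (n * \<alpha>) < \<epsilon>} \<le> 2 * \<epsilon> * q + 3"
proof -
  define c where "c = m * (\<alpha> - p / q)"
  let ?r = "\<lambda>n. int n * p mod int q"
  let ?A = "{n\<in>{m<..m + q}. dist_nearest_int (n * \<alpha>) < \<epsilon>}"
  let ?R = "\<lambda>\<delta>. {r\<in>{0..<int q}. dist_nearest_int (of_int r / q + c) < \<delta>}"
  have close: "\<bar>n * \<alpha> - (of_int (?r n) / q + c) - of_int (int n * p div int q)\<bar> \<le> 1 / q"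
    if n: "n \<in> {m<..m + q}" for n :: nat
  proof -
    have "n * p / q = of_int (?r n) / q + of_int (int n * p div int q)"
      using of_int_div_aux[where 'a = real, of "int n * p" "int q"] by simp
    then have "n * \<alpha> - (of_int (?r n) / q + c) - of_int (int n * p div int q)
        = n * \<alpha> - n * p / q - c" by linarith
    also have "\<dots> = (real n - real m) / q * (q * \<alpha> - p)"
      using q by (simp add: c_def field_simps)
    also have "\<bar>\<dots>\<bar> \<le> 1 * (1 / q)"
      unfolding abs_mult using n appr by (intro mult_mono) (auto simp: divide_simps)
    finally show ?thesis by simp
  qed
  have near: "dist_nearest_int (of_int (?r n) / q + c) \<le> dist_nearest_int (n * \<alpha>) + 1 / q"
      "dist_nearest_int (n * \<alpha>) \<le> dist_nearest_int (of_int (?r n) / q + c) + 1 / q"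
    if n: "n \<in> {m<..m + q}" for n :: nat
    using close[OF n]
      dist_nearest_int_le_shift[of "of_int (?r n) / q + c" "n * \<alpha>" "- (int n * p div int q)"]
      dist_nearest_int_le_shift[of "n * \<alpha>" "of_int (?r n) / q + c" "int n * p div int q"]
    unfolding of_int_minus by linarith+
  have bij: "bij_betw ?r {m<..m + q} {0..<int q}"
    using q cop by (rule bij_betw_mult_mod_block)
  have card_r: "card (?r ` ?A) = card ?A"
    by (rule card_image) (use bij in \<open>auto simp: bij_betw_def inj_on_def\<close>)
  have "?R (\<epsilon> - 1 / q) \<subseteq> ?r ` ?A"
  proof
    fix s assume s: "s \<in> ?R (\<epsilon> - 1 / q)"
    then have "s \<in> ?r ` {m<..m + q}"
      using bij_betw_imp_surj_on[OF bij] by simp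
    then obtain n where n: "n \<in> {m<..m + q}" "s = ?r n" by blast
    then have "n \<in> ?A" using near(2)[OF n(1)] s by auto
    then show "s \<in> ?r ` ?A" using n(2) by blast
  qed
  then have "card (?R (\<epsilon> - 1 / q)) \<le> card ?A"
    unfolding card_r[symmetric] by (intro card_mono) auto
  moreover have "\<epsilon> - 1 / q \<le> 1 / 2" using \<epsilon>(2) by (simp add: add_increasing2 diff_le_eq)
  moreover have "2 * (\<epsilon> - 1 / q) * q = 2 * \<epsilon> * q - 2" "2 * (\<epsilon> + 1 / q) * q = 2 * \<epsilon> * q + 2"
    using q by (simp_all add: field_simps)
  ultimately show "2 * \<epsilon> * q - 3 \<le> card ?A"
    using card_shifted_fractions_near_int(1)[OF q, of "\<epsilon> - 1 / q" c] by linarith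
  have "?r ` ?A \<subseteq> ?R (\<epsilon> + 1 / q)"
  proof (rule image_subsetI)
    fix n assume "n \<in> ?A"
    then have n: "n \<in> {m<..m + q}" "dist_nearest_int (n * \<alpha>) < \<epsilon>" by auto
    show "?r n \<in> ?R (\<epsilon> + 1 / q)" using near(1)[OF n(1)] n(2) q by simp
  qed
  moreover have "finite (?R (\<epsilon> + 1 / q))"
    by (rule finite_subset[of _ "{0..<int q}"]) auto
  ultimately have "card ?A \<le> card (?R (\<epsilon> + 1 / q))"
    unfolding card_r[symmetric] by (intro card_mono)
  then show "card ?A \<le> 2 * \<epsilon> * q + 3"
    using card_shifted_fractions_near_int(2)[OF q, of "\<epsilon> + 1 / q" c] \<epsilon>(1)
      \<open>2 * (\<epsilon> + 1 / q) * q = 2 * \<epsilon> * q + 2\<close> by simp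
qed

section \<open>Summing over blocks\<close>

lemma card_initial_blocks:
  fixes a b :: real and P :: "nat \<Rightarrow> bool" and k q :: nat
  assumes "\<And>m. a \<le> card {n\<in>{m<..m + q}. P n}" "\<And>m. card {n\<in>{m<..m + q}. P n} \<le> b"
  shows "k * a \<le> real (card {n\<in>{0<..k * q}. P n}) \<and> real (card {n\<in>{0<..k * q}. P n}) \<le> k * b"
proof (induction k)
  case 0
  then show ?case by simp
next
  case (Suc k)
  have "{n\<in>{0<..Suc k * q}. P n} = {n\<in>{0<..k * q}. P n} \<union> {n\<in>{k * q<..k * q + q}. P n}"
    by auto
  then have "card {n\<in>{0<..Suc k * q}. P n}
      = card {n\<in>{0<..k * q}. P n} + card {n\<in>{k * q<..k * q + q}. P n}"
    by (simp add: card_Un_disjoint disjoint_iff)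
  then show ?case
    using Suc assms[of "k * q"] by (simp add: distrib_right)
qed

text \<open>
  With \<open>k\<close> the quotient of \<open>N\<close> by \<open>q\<close>, the set \<open>{1..N}\<close> contains \<open>k\<close> full blocks and is covered by
  \<open>k + 1\<close>. Since \<open>q \<le> N/4\<close>, the full blocks have total length at least \<open>3N/4\<close>; since \<open>\<epsilon>q \<ge> 6\<close>, each
  contributes at least \<open>2\<epsilon>q - 3 \<ge> 3\<epsilon>q/2\<close>. As \<open>3/4 \<cdot> 3/2 > 1\<close>, the lower bound has constant 1.
\<close>
lemma card_near_int_bounds:
  fixes \<alpha> \<epsilon> :: real and p :: int and q N :: nat
  assumes q: "q > 0" and cop: "coprime p (int q)" and appr: "\<bar>q * \<alpha> - p\<bar> \<le> 1 / q"
    and \<epsilon>: "0 \<le> \<epsilon>" "\<epsilon> \<le> 1 / 2" and large: "6 \<le> \<epsilon> * q" and small: "4 * q \<le> N"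
  shows "\<epsilon> * real N \<le> real (card {n::nat. n \<ge> 1 \<and> dist_nearest_int (real n * \<alpha>) < \<epsilon> \<and> n \<le> N})"
    and "real (card {n::nat. n \<ge> 1 \<and> dist_nearest_int (real n * \<alpha>) < \<epsilon> \<and> n \<le> N}) \<le> 32 * \<epsilon> * real N"
proof -
  let ?C = "{n::nat. n \<ge> 1 \<and> dist_nearest_int (real n * \<alpha>) < \<epsilon> \<and> n \<le> N}"
  let ?B = "\<lambda>k. {n\<in>{0<..k * q}. dist_nearest_int (real n * \<alpha>) < \<epsilon>}"
  let ?k = "N div q"
  note blocks = card_initial_blocks[where P = "\<lambda>n. dist_nearest_int (real n * \<alpha>) < \<epsilon>",
      OF card_block_near_int[OF q cop appr \<epsilon>]]
  have kq: "?k * q \<le> N" "N < (?k + 1) * q"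
    using q dividend_less_div_times[of q N] by simp_all
  have "real (?k * q) \<le> N" "real N < real ((?k + 1) * q)"
    using kq by (simp_all only: of_nat_le_iff of_nat_less_iff)
  then have kq': "real ?k * q \<le> N" "real N < (real ?k + 1) * q"
    by (simp_all add: algebra_simps)
  have "4 * real q \<le> N" using small by linarith
  \<comment> \<open>Only \<open>4\<epsilon>q/3\<close> of the \<open>3\<epsilon>q/2\<close> available per block is needed to cancel the factor \<open>3/4\<close>.\<close>
  have "\<epsilon> * N = (3 / 4 * N) * (4 / 3 * \<epsilon>)" by simp
  also have "\<dots> \<le> (?k * q) * (4 / 3 * \<epsilon>)"
    using kq' \<open>4 * real q \<le> N\<close> \<epsilon> by (intro mult_right_mono) (auto simp: distrib_right)
  also have "\<dots> = ?k * (4 / 3 * (\<epsilon> * q))" by simp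
  also have "\<dots> \<le> ?k * (2 * \<epsilon> * q - 3)"
    using large by (intro mult_left_mono) auto
  also have "\<dots> \<le> card (?B ?k)" using blocks by blast
  also have "real (card (?B ?k)) \<le> real (card ?C)"
    unfolding of_nat_le_iff by (intro card_mono) (auto intro: order_trans[OF _ kq(1)])
  finally show "\<epsilon> * real N \<le> real (card ?C)" .
  have "real (card ?C) \<le> real (card (?B (?k + 1)))"
    unfolding of_nat_le_iff using kq by (intro card_mono) auto
  also have "\<dots> \<le> real (?k + 1) * (2 * \<epsilon> * q + 3)" using blocks by blast
  also have "\<dots> \<le> real (?k + 1) * (5 / 2 * (\<epsilon> * q))"
    using large by (intro mult_left_mono) auto
  also have "\<dots> = (real ?k * q + q) * (5 / 2 * \<epsilon>)" by (simp add: algebra_simps)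
  also have "\<dots> \<le> (2 * N) * (5 / 2 * \<epsilon>)"
    using kq' \<open>4 * real q \<le> N\<close> \<epsilon> by (intro mult_right_mono) auto
  also have "\<dots> \<le> 32 * \<epsilon> * N" using \<epsilon> by simp
  finally show "real (card ?C) \<le> 32 * \<epsilon> * real N" .
qed

section \<open>Existence of a suitable denominator\<close>

text \<open>
  Dirichlet's theorem bounds \<open>q\<close> from above, and the exponent of approximation bounds it from below:
  a small \<open>q\<close> cannot make \<open>q\<alpha>\<close> as close to an integer as Dirichlet's theorem promises.
\<close>
lemma eventually_denominator_between:
  fixes \<alpha> \<nu> :: real
  assumes irr: "\<alpha> \<notin> \<rat>" and \<nu>: "0 < \<nu>" "ereal \<nu> < 1 / approx_exponent \<alpha>"
  shows "\<forall>\<^sub>F N::nat in sequentially. \<exists>p (q::nat). q > 0 \<and> coprime p (int q)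
    \<and> \<bar>q * \<alpha> - of_int p\<bar> \<le> 1 / q \<and> 6 * real N powr \<nu> \<le> q \<and> 4 * q \<le> N"
proof -
  have "approx_exponent \<alpha> < ereal (1 / \<nu>)"
  proof (cases "approx_exponent \<alpha>")
    case (real e)
    show ?thesis
    proof (cases "e > 0")
      case True
      then show ?thesis using \<nu> real by (simp add: one_ereal_def field_simps)
    next
      case False
      then show ?thesis using \<nu>(1) real
        by (simp add: not_less) (meson divide_pos_pos le_less_trans zero_less_one)
    qed
    \<comment> \<open>An infinite exponent has reciprocal 0, which is excluded by \<open>\<nu> > 0\<close>.\<close>
  qed (use \<nu> in auto)
  then obtain w where w: "approx_exponent \<alpha> < ereal w" "w < 1 / \<nu>" "w > 0"
  proof -
    assume *: "\<And>w. approx_exponent \<alpha> < ereal w \<Longrightarrow> w < 1 / \<nu> \<Longrightarrow> w > 0 \<Longrightarrow> thesis"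
    have "max (approx_exponent \<alpha>) 0 < ereal (1 / \<nu>)"
      using \<open>approx_exponent \<alpha> < ereal (1 / \<nu>)\<close> \<nu>(1) by simp
    then obtain w where "max (approx_exponent \<alpha>) 0 < ereal w" "ereal w < ereal (1 / \<nu>)"
      using ereal_dense2 by blast
    then show thesis by (intro *[of w]) auto
  qed
  obtain c where c: "c > 0" "\<And>q::nat. q \<ge> 1 \<Longrightarrow> c * real q powr (- w) \<le> dist_nearest_int (real q * \<alpha>)"
    using dist_nearest_int_ge_powr[OF irr w(3,1)] by blast
  \<comment> \<open>The gap between \<open>w\<close> and \<open>1/\<nu>\<close> is what absorbs the constants 6, \<open>c\<close> and 4 for large \<open>N\<close>.\<close>
  define u where "u = \<nu> * w"
  have u: "u < 1" using w(2) \<nu>(1) by (simp add: u_def field_simps)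
  have ev: "\<forall>\<^sub>F N::nat in sequentially. 6 powr w * real N powr u < c * (real N / 4 - 1)"
    using u c(1) by real_asymp
  show ?thesis
    using ev eventually_ge_at_top[of 4]
  proof eventually_elim
    case (elim N)
    define T where "T = N div 4"
    have T: "T > 0" "4 * T \<le> N" "real N / 4 - 1 < T"
      using elim(2) by (auto simp: T_def)
    obtain p k where pk: "coprime p k" "0 < k" "k \<le> int T" "\<bar>of_int k * \<alpha> - of_int p\<bar> < 1 / T"
      using Dirichlet_approx_coprime[OF T(1)] by blast
    define q where "q = nat k"
    have q: "k = int q" "q > 0" "q \<le> T" using pk by (auto simp: q_def)
    have less: "\<bar>q * \<alpha> - of_int p\<bar> < 1 / T" using pk(4) q(1) by simp
    also have "1 / real T \<le> 1 / q" using q by (intro divide_left_mono) auto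
    finally have "\<bar>q * \<alpha> - of_int p\<bar> \<le> 1 / q" by simp
    moreover have "6 * real N powr \<nu> \<le> q"
    proof (rule ccontr)
      assume "\<not> 6 * real N powr \<nu> \<le> q"
      then have "real q powr w \<le> (6 * real N powr \<nu>) powr w"
        using w(3) by (intro powr_mono2) auto
      also have "\<dots> = 6 powr w * real N powr u"
        by (simp add: powr_mult powr_powr u_def)
      also have "\<dots> < c * T"
        using elim(1) mult_strict_left_mono[OF T(3) c(1)] by linarith
      finally have "1 / T < c * real q powr (- w)"
        using q T by (simp add: powr_minus field_simps)
      also have "\<dots> \<le> dist_nearest_int (real q * \<alpha>)" using c(2)[of q] q by simp
      also have "\<dots> < 1 / T" using less dist_nearest_int_le le_less_trans by blast
      finally have "1 / real T < 1 / real T" .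
      then show False by simp
    qed
    ultimately show ?case using pk q T by (intro exI[of _ p] exI[of _ q]) auto
  qed
qed

section \<open>Counting multiples near an integer\<close>

theorem corollary6p1:
  fixes \<alpha> :: real
  assumes "\<alpha> \<notin> \<rat>" and "\<not> liouville \<alpha>"
  shows "\<exists>\<epsilon>\<^sub>0>0. \<forall>\<nu>::real. 0 < \<nu> \<and> ereal \<nu> < 1 / approx_exponent \<alpha> \<longrightarrow>
    (\<forall>\<^sub>F N::nat in sequentially. \<forall>\<epsilon>::real. real N powr (- \<nu>) < \<epsilon> \<and> \<epsilon> < \<epsilon>\<^sub>0 \<longrightarrow>
       \<lfloor>\<epsilon> * real N\<rfloor> \<le> int (card {n::nat. n \<ge> 1 \<and> dist_nearest_int (real n * \<alpha>) < \<epsilon> \<and> n \<le> N}) \<and>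
       real (card {n::nat. n \<ge> 1 \<and> dist_nearest_int (real n * \<alpha>) < \<epsilon> \<and> n \<le> N}) \<le> 32 * \<epsilon> * real N)"
proof (intro exI[of _ "1 / 2 :: real"] conjI allI impI)
  fix \<nu> :: real
  assume \<nu>: "0 < \<nu> \<and> ereal \<nu> < 1 / approx_exponent \<alpha>"
  have "\<forall>\<^sub>F N::nat in sequentially. \<exists>p (q::nat). q > 0 \<and> coprime p (int q)
      \<and> \<bar>q * \<alpha> - of_int p\<bar> \<le> 1 / q \<and> 6 * real N powr \<nu> \<le> q \<and> 4 * q \<le> N"
    using \<nu> by (intro eventually_denominator_between assms(1)) auto
  then show "\<forall>\<^sub>F N::nat in sequentially. \<forall>\<epsilon>::real. real N powr (- \<nu>) < \<epsilon> \<and> \<epsilon> < 1 / 2 \<longrightarrow>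
       \<lfloor>\<epsilon> * real N\<rfloor> \<le> int (card {n::nat. n \<ge> 1 \<and> dist_nearest_int (real n * \<alpha>) < \<epsilon> \<and> n \<le> N}) \<and>
       real (card {n::nat. n \<ge> 1 \<and> dist_nearest_int (real n * \<alpha>) < \<epsilon> \<and> n \<le> N}) \<le> 32 * \<epsilon> * real N"
  proof eventually_elim
    case (elim N)
    then obtain p and q :: nat where q: "q > 0" "coprime p (int q)" "\<bar>q * \<alpha> - of_int p\<bar> \<le> 1 / q"
        "6 * real N powr \<nu> \<le> q" "4 * q \<le> N" by blast
    show ?case
    proof (intro allI impI)
      fix \<epsilon> :: real assume \<epsilon>: "real N powr (- \<nu>) < \<epsilon> \<and> \<epsilon> < 1 / 2"
      have N: "real N powr \<nu> > 0" using q(1,5) by simp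
      have "0 \<le> \<epsilon>" "\<epsilon> \<le> 1 / 2" using \<epsilon> powr_ge_zero[of "real N" "- \<nu>"] by linarith+
      have "6 = real N powr (- \<nu>) * (6 * real N powr \<nu>)"
        using N by (simp add: powr_minus)
      also have "\<dots> \<le> \<epsilon> * q"
        using \<epsilon> q(4) \<open>0 \<le> \<epsilon>\<close> by (intro mult_mono) auto
      finally have "6 \<le> \<epsilon> * q" .
      note bounds = card_near_int_bounds[OF q(1-3) \<open>0 \<le> \<epsilon>\<close> \<open>\<epsilon> \<le> 1 / 2\<close> this q(5)]
      show "\<lfloor>\<epsilon> * real N\<rfloor> \<le> int (card {n::nat. n \<ge> 1 \<and> dist_nearest_int (real n * \<alpha>) < \<epsilon> \<and> n \<le> N}) \<and>
          real (card {n::nat. n \<ge> 1 \<and> dist_nearest_int (real n * \<alpha>) < \<epsilon> \<and> n \<le> N}) \<le> 32 * \<epsilon> * real N"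
        using bounds by (simp add: floor_le_iff)
    qed
  qed
qed simp

end
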